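(* Consider the two-player lattice convex-quadratic simultaneous game in which the $x$-player solves $\min_{x\in\Lambda_1}\frac12 x^\top Q_1x+(C_1y+d_1)^\top x$ and the $y$-player solves $\min_{y\in\Lambda_2}\frac12 y^\top Q_2y+(C_2x+d_2)^\top y$, where $\Lambda_1\subset\mathbb{R}^{n_x}$ and $\Lambda_2\subset\mathbb{R}^{n_y}$ are full-rank lattices, and $Q_1,Q_2$ are symmetric positive definite. If the game has positively adequate objectives (every singular value of $R_1=Q_1^{-1}C_1$ and of $R_2=Q_2^{-1}C_2$ is strictly less than $1$), then the Best-Response Algorithm terminates after finitely many iterations, irrespective of the initial point $(\hat x^0,\hat y^0)\in\Lambda_1\times\Lambda_2$.
   Context: Here $C_1\in\mathbb{R}^{n_x\times n_y}$, $C_2\in\mathbb{R}^{n_y\times n_x}$, $d_1\in\mathbb{R}^{n_x}$, $d_2\in\mathbb{R}^{n_y}$. A full-rank lattice in $\mathbb{R}^n$ is the set of all integer combinations of $n$ linearly independent vectors of $\mathbb{R}^n$. The singular values of an $m\times n$ real matrix $M$ are the square roots of the $n$ eigenvalues of $M^\top M$. Best responses: $\mathcal{B}_1(y)$ denotes an element of $\arg\min_{x\in\Lambda_1}\{\frac12x^\top Q_1x+(C_1y+d_1)^\top x\}$ and $\mathcal{B}_2(x)$ denotes an element of $\arg\min_{y\in\Lambda_2}\{\frac12y^\top Q_2y+(C_2x+d_2)^\top y\}$; if there are several minimizers an arbitrary one is chosen. Best-Response Algorithm: given $(\hat x^0,\hat y^0)\in\Lambda_1\times\Lambda_2$, for $i=1,2,\dots$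 set $\hat x^i=\mathcal{B}_1(\hat y^{i-1})$ and $\hat y^i=\mathcal{B}_2(\hat x^{i-1})$; if $(\hat x^i,\hat y^i)=(\hat x^k,\hat y^k)$ for some $k<i$, terminate and return $S_x=\{\hat x^k,\dots,\hat x^i\}$, $S_y=\{\hat y^k,\dots,\hat y^i\}$. *)

theory Defs
  imports "HOL-Analysis.Analysis"
begin

definition full_rank_lattice :: "(real ^ 'n) set \<Rightarrow> bool" where
  "full_rank_lattice L \<longleftrightarrow>
     (\<exists>b :: 'n \<Rightarrow> real ^ 'n. inj b \<and> independent (range b) \<and>
        L = {(\<Sum>i\<in>UNIV. of_int (c i) *\<^sub>R b i) | c :: 'n \<Rightarrow> int. True})"

definition symmetric_positive_definite :: "real ^ 'n ^ 'n \<Rightarrow> bool" where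
  "symmetric_positive_definite Q \<longleftrightarrow>
     transpose Q = Q \<and> (\<forall>v. v \<noteq> 0 \<longrightarrow> v \<bullet> (Q *v v) > 0)"

definition eigenvalues :: "real ^ 'n ^ 'n \<Rightarrow> real set" where
  "eigenvalues A = {l. \<exists>v. v \<noteq> 0 \<and> A *v v = l *\<^sub>R v}"

(* For M with m rows and n columns, transpose M ** M is n x n and symmetric positive
   semidefinite, so its n eigenvalues are all real and nonnegative.  Multiplicities are dropped. *)
definition singular_values :: "real ^ 'n ^ 'm \<Rightarrow> real set" where
  "singular_values M = sqrt ` eigenvalues (transpose M ** M)"

definition positively_adequate ::
  "real ^ 'nx ^ 'nx \<Rightarrow> real ^ 'ny ^ 'nx \<Rightarrow> real ^ 'ny ^ 'ny \<Rightarrow> real ^ 'nx ^ 'ny \<Rightarrow> bool" where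
  "positively_adequate Q1 C1 Q2 C2 \<longleftrightarrow>
     (\<forall>s \<in> singular_values (matrix_inv Q1 ** C1). s < 1) \<and>
     (\<forall>s \<in> singular_values (matrix_inv Q2 ** C2). s < 1)"

(* u is the player's own decision, w the opponent's. *)
definition objective ::
  "real ^ 'n ^ 'n \<Rightarrow> real ^ 'm ^ 'n \<Rightarrow> real ^ 'n \<Rightarrow> real ^ 'm \<Rightarrow> real ^ 'n \<Rightarrow> real" where
  "objective Q C d w u = 1 / 2 * (u \<bullet> (Q *v u)) + (C *v w + d) \<bullet> u"

definition best_responses ::
  "(real ^ 'n) set \<Rightarrow> real ^ 'n ^ 'n \<Rightarrow> real ^ 'm ^ 'n \<Rightarrow> real ^ 'n \<Rightarrow> real ^ 'm \<Rightarrow> (real ^ 'n) set"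
where
  "best_responses L Q C d w = {u. is_arg_min (objective Q C d w) (\<lambda>u. u \<in> L) u}"

(* The best-response algorithm, for arbitrary set-valued best responses BR1 and BR2: each
   iteration chooses freely among the minimizers, and choices may differ between visits to the
   same point.  z i is the i-th iterate, a pair (x, y). *)

definition br_step ::
  "('y \<Rightarrow> 'x set) \<Rightarrow> ('x \<Rightarrow> 'y set) \<Rightarrow> 'x \<times> 'y \<Rightarrow> 'x \<times> 'y \<Rightarrow> bool" where
  "br_step BR1 BR2 p q \<longleftrightarrow> fst q \<in> BR1 (snd p) \<and> snd q \<in> BR2 (fst p)"

definition br_stop :: "(nat \<Rightarrow> 'x \<times> 'y) \<Rightarrow> nat \<Rightarrow> bool" where
  "br_stop z i \<longleftrightarrow> (\<exists>k<i. z i = z k)"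

(* z 0, ..., z n are the iterates of a (possibly unfinished) execution; later values of z are
   irrelevant. *)
definition br_execution ::
  "('y \<Rightarrow> 'x set) \<Rightarrow> ('x \<Rightarrow> 'y set) \<Rightarrow> 'x \<times> 'y \<Rightarrow> (nat \<Rightarrow> 'x \<times> 'y) \<Rightarrow> nat \<Rightarrow> bool" where
  "br_execution BR1 BR2 p z n \<longleftrightarrow>
     z 0 = p \<and> (\<forall>i<n. \<not> br_stop z i \<and> br_step BR1 BR2 (z i) (z (Suc i)))"

(* Whatever minimizers are chosen, the algorithm cannot run forever; nor can it get stuck
   before its stopping test succeeds because some best response does not exist. *)
definition br_algorithm_terminates ::
  "('y \<Rightarrow> 'x set) \<Rightarrow> ('x \<Rightarrow> 'y set) \<Rightarrow> 'x \<times> 'y \<Rightarrow> bool" where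
  "br_algorithm_terminates BR1 BR2 p \<longleftrightarrow>
     (\<nexists>z. \<forall>n. br_execution BR1 BR2 p z n) \<and>
     (\<forall>z n. br_execution BR1 BR2 p z n \<and> \<not> br_stop z n \<longrightarrow> (\<exists>q. br_step BR1 BR2 (z n) q))"

end

theory Submission
  imports Defs
begin

text \<open>
  A best response minimises the distance, in the norm induced by \<open>Q\<close>, from the lattice to the
  unconstrained minimiser \<open>- R w - Q\<inverse> d\<close>, where \<open>R = Q\<inverse> C\<close>. The lattice has finite covering radius,
  so a best response to \<open>w\<close> has norm at most \<open>r * norm w + K\<close>, where \<open>r < 1\<close> is a bound for the
  singular values of \<open>R\<close> and \<open>K\<close> does not depend on \<open>w\<close>. Hence all iterates stay in a ball, which
  contains only finitely many lattice points, and some iterate is repeated.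
\<close>

section \<open>Lattices\<close>

text \<open>The linear map \<open>g\<close> carrying the lattice basis to the standard basis reads
  off the integer coordinates of a lattice point. Being bounded, it confines these coordinates to a
  box when the norm is bounded.\<close>

lemma full_rank_lattice_finite_bounded:
  fixes L :: "(real ^ 'n) set"
  assumes "full_rank_lattice L"
  shows "finite {u \<in> L. norm u \<le> B}"
proof -
  obtain b :: "'n \<Rightarrow> real ^ 'n" where b: "inj b" "independent (range b)"
    and L: "L = {(\<Sum>i\<in>UNIV. of_int (c i) *\<^sub>R b i) | c :: 'n \<Rightarrow> int. True}"
    using assms unfolding full_rank_lattice_def by blast
  obtain g :: "real ^ 'n \<Rightarrow> real ^ 'n" where g: "linear g"
    "\<And>x. x \<in> range b \<Longrightarrow> g x = axis (inv b x) 1"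
    using linear_independent_extend[OF b(2), of "\<lambda>x. axis (inv b x) (1::real)"] by blast
  have gb: "g (b i) = axis i 1" for i
    using g(2) b(1) by simp
  have coord: "g (\<Sum>i\<in>UNIV. of_int (c i) *\<^sub>R b i) $ j = of_int (c j)" for c :: "'n \<Rightarrow> int" and j
    by (simp add: linear_sum[OF g(1)] linear_cmul[OF g(1)] gb axis_def if_distrib cong: if_cong)
  obtain K where K: "K > 0" "\<And>x. norm (g x) \<le> norm x * K"
    using bounded_linear.pos_bounded[OF linear_conv_bounded_linear[THEN iffD1, OF g(1)]] by blast
  define N where "N = \<lceil>B * K\<rceil>"
  have "{u \<in> L. norm u \<le> B} \<subseteq>
      (\<lambda>c. \<Sum>i\<in>UNIV. of_int (c i) *\<^sub>R b i) ` (PiE UNIV (\<lambda>_. {- N..N}))"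
  proof clarify
    fix u assume "u \<in> L" and nu: "norm u \<le> B"
    then obtain c :: "'n \<Rightarrow> int" where u: "u = (\<Sum>i\<in>UNIV. of_int (c i) *\<^sub>R b i)"
      using L by blast
    have "c j \<in> {- N..N}" for j
    proof -
      have "\<bar>real_of_int (c j)\<bar> = \<bar>g u $ j\<bar>"
        unfolding u coord ..
      also have "\<dots> \<le> norm (g u)"
        by (rule component_le_norm_cart)
      also have "\<dots> \<le> norm u * K"
        by (rule K(2))
      also have "\<dots> \<le> B * K"
        using nu K(1) by simp
      finally have "\<bar>real_of_int (c j)\<bar> \<le> real_of_int N"
        unfolding N_def by linarith
      then have "\<bar>c j\<bar> \<le> N"
        by linarith
      then show ?thesis by (simp add: abs_le_iff)
    qed
    then show "u \<in> (\<lambda>c. \<Sum>i\<in>UNIV. of_int (c i) *\<^sub>R b i) ` (PiE UNIV (\<lambda>_. {- N..N}))"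
      unfolding u by blast
  qed
  then show ?thesis
    by (rule finite_subset) (intro finite_imageI finite_PiE; simp)
qed

text \<open>Rounding down every coordinate of \<open>v\<close> in the lattice basis displaces it by
  at most the sum of the norms of the basis vectors, whatever \<open>v\<close> is.\<close>

lemma full_rank_lattice_covering_radius:
  fixes L :: "(real ^ 'n) set"
  assumes "full_rank_lattice L"
  obtains K where "\<And>v. \<exists>u\<in>L. norm (u - v) \<le> K"
proof -
  obtain b :: "'n \<Rightarrow> real ^ 'n" where b: "inj b" "independent (range b)"
    and L: "L = {(\<Sum>i\<in>UNIV. of_int (c i) *\<^sub>R b i) | c :: 'n \<Rightarrow> int. True}"
    using assms unfolding full_rank_lattice_def by blast
  have "UNIV \<subseteq> span (range b)"
    using b by (intro card_ge_dim_independent) (auto simp: card_image)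
  have "\<exists>u\<in>L. norm (u - v) \<le> (\<Sum>i\<in>UNIV. norm (b i))" for v
  proof -
    have "v \<in> span (range b)"
      using \<open>UNIV \<subseteq> span (range b)\<close> by blast
    then obtain h where "v = (\<Sum>x\<in>range b. h x *\<^sub>R x)"
      by (auto simp: span_finite)
    then have v: "v = (\<Sum>i\<in>UNIV. h (b i) *\<^sub>R b i)"
      by (simp add: sum.reindex[OF b(1)])
    let ?u = "\<Sum>i\<in>UNIV. of_int \<lfloor>h (b i)\<rfloor> *\<^sub>R b i"
    have "?u - v = (\<Sum>i\<in>UNIV. (of_int \<lfloor>h (b i)\<rfloor> - h (b i)) *\<^sub>R b i)"
      by (simp add: v sum_subtractf scaleR_left_diff_distrib)
    also have "norm \<dots> \<le> (\<Sum>i\<in>UNIV. norm (b i))"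
    proof (rule sum_norm_le)
      fix i
      have "\<bar>of_int \<lfloor>h (b i)\<rfloor> - h (b i)\<bar> \<le> 1"
        by linarith
      then show "norm ((of_int \<lfloor>h (b i)\<rfloor> - h (b i)) *\<^sub>R b i) \<le> norm (b i)"
        by (simp add: mult_left_le_one_le)
    qed
    finally have "norm (?u - v) \<le> (\<Sum>i\<in>UNIV. norm (b i))" .
    moreover have "?u \<in> L"
      unfolding L by (rule CollectI) (rule exI[of _ "\<lambda>i. \<lfloor>h (b i)\<rfloor>"], simp)
    ultimately show ?thesis by blast
  qed
  then show ?thesis by (rule that)
qed

section \<open>Quadratic forms\<close>

lemma inner_transpose_matrix:
  fixes A :: "real ^ 'n ^ 'm"
  shows "(A *v x) \<bullet> y = x \<bullet> (transpose A *v y)"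
  by (metis dot_lmul_matrix inner_commute transpose_matrix_vector)

lemma continuous_on_quadratic_form:
  fixes A :: "real ^ 'n ^ 'n"
  shows "continuous_on S (\<lambda>v. v \<bullet> (A *v v))"
  by (intro continuous_intros linear_continuous_on
      linear_conv_bounded_linear[THEN iffD1] matrix_vector_mul_linear)

text \<open>Compactness of the unit sphere gives a minimiser there, and homogeneity of degree two
  extends the bound to all vectors. It serves both for the definiteness constant of \<open>Q\<close>
  and for the largest singular value of \<open>R\<close>.\<close>

lemma quadratic_form_attains_min:
  fixes A :: "real ^ 'n ^ 'n"
  shows "\<exists>v. norm v = 1 \<and> (\<forall>w. (v \<bullet> (A *v v)) * (norm w)\<^sup>2 \<le> w \<bullet> (A *v w))"
proof -
  have "sphere (0 :: real ^ 'n) 1 \<noteq> {}"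
    by simp
  then obtain v where v: "v \<in> sphere (0 :: real ^ 'n) 1"
    "\<And>w. w \<in> sphere 0 1 \<Longrightarrow> v \<bullet> (A *v v) \<le> w \<bullet> (A *v w)"
    using continuous_attains_inf[OF compact_sphere _ continuous_on_quadratic_form] by meson
  have "(v \<bullet> (A *v v)) * (norm w)\<^sup>2 \<le> w \<bullet> (A *v w)" for w
  proof (cases "w = 0")
    case False
    let ?e = "w /\<^sub>R norm w"
    have "v \<bullet> (A *v v) \<le> ?e \<bullet> (A *v ?e)"
      using False by (intro v(2)) simp
    also have "\<dots> = w \<bullet> (A *v w) / (norm w)\<^sup>2"
      by (simp add: matrix_vector_mult_scaleR power2_eq_square divide_simps)
    finally show ?thesis
      using False by (simp add: pos_le_divide_eq)
  qed simp
  then show ?thesis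
    using v(1) by auto
qed

lemma quadratic_form_diff:
  fixes Q :: "real ^ 'n ^ 'n"
  assumes "transpose Q = Q"
  shows "(u - c) \<bullet> (Q *v (u - c)) = u \<bullet> (Q *v u) - 2 * ((Q *v c) \<bullet> u) + c \<bullet> (Q *v c)"
proof -
  have "(Q *v c) \<bullet> u = c \<bullet> (Q *v u)"
    using inner_transpose_matrix[of Q c u] assms by simp
  then show ?thesis
    by (simp add: matrix_vector_mult_diff_distrib inner_diff_left inner_diff_right inner_commute)
qed

text \<open>The first-order condition at \<open>v\<close>, tested along the direction \<open>A v\<close>.\<close>

lemma positive_semidefinite_null_vector:
  fixes A :: "real ^ 'n ^ 'n"
  assumes sym: "transpose A = A" and psd: "\<And>w. 0 \<le> w \<bullet> (A *v w)" and null: "v \<bullet> (A *v v) = 0"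
  shows "A *v v = 0"
proof -
  define w where "w = A *v v"
  define c where "c = w \<bullet> (A *v w)"
  define s where "s = w \<bullet> w"
  \<comment> \<open>The quadratic \<open>t\<^sup>2 * c - 2 * t * s\<close> has its minimum at
    \<open>s / c\<close>. The added 1 covers the case \<open>c = 0\<close> and still makes the value
    negative unless \<open>s = 0\<close>.\<close>
  define t where "t = s / (c + 1)"
  have c: "c \<ge> 0"
    unfolding c_def by (rule psd)
  have "0 \<le> (v - t *\<^sub>R w) \<bullet> (A *v (v - t *\<^sub>R w))"
    by (rule psd)
  also have "\<dots> = t\<^sup>2 * c - 2 * t * s"
    using inner_transpose_matrix[of A w v] sym null
    by (simp add: quadratic_form_diff[OF sym] matrix_vector_mult_scaleR c_def s_def
        power2_eq_square flip: w_def)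
  also have "\<dots> = - (s\<^sup>2 * (c + 2) / (c + 1)\<^sup>2)"
    using c by (simp add: t_def divide_simps) (simp add: power2_eq_square algebra_simps)
  finally have "s\<^sup>2 * (c + 2) / (c + 1)\<^sup>2 \<le> 0"
    by simp
  then have "s = 0"
    using c by (auto simp: divide_le_0_iff mult_le_0_iff power2_less_eq_zero_iff)
  then show ?thesis
    by (simp add: s_def w_def)
qed

text \<open>The maximum of \<open>norm (R *v w)\<close> over unit vectors is attained, and an
  extremal argument shows that it is itself a singular value, hence less than 1. It then serves as
  the contraction factor.\<close>

lemma singular_values_less_one_contraction:
  fixes R :: "real ^ 'n ^ 'm"
  assumes sv: "\<forall>s \<in> singular_values R. s < 1"
  obtains r where "0 \<le> r" "r < 1" "\<And>w. norm (R *v w) \<le> r * norm w"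
proof -
  let ?S = "transpose R ** R"
  have quad: "w \<bullet> (?S *v w) = (norm (R *v w))\<^sup>2" for w
    by (metis inner_transpose_matrix matrix_vector_mul_assoc power2_norm_eq_inner)
  \<comment> \<open>The sign turns the minimiser into a unit vector at which
    \<open>norm (R *v w)\<close> is largest.\<close>
  obtain v where v: "norm v = 1"
    "\<And>w. (v \<bullet> ((- ?S) *v v)) * (norm w)\<^sup>2 \<le> w \<bullet> ((- ?S) *v w)"
    using quadratic_form_attains_min[of "- ?S"] by blast
  have neg: "(- ?S) *v w = - (?S *v w)" for w
    by (simp add: vec_eq_iff matrix_vector_mult_def sum_negf)
  let ?r = "norm (R *v v)"
  have bound: "(norm (R *v w))\<^sup>2 \<le> ?r\<^sup>2 * (norm w)\<^sup>2" for w
    using v(2)[of w] by (simp add: neg quad)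
  \<comment> \<open>By maximality of \<open>?r\<close> this matrix is positive semidefinite, and its
    form vanishes at \<open>v\<close>. So \<open>v\<close> lies in its kernel, which makes
    \<open>v\<close> an eigenvector of \<open>?S\<close> with eigenvalue
    \<open>?r\<^sup>2\<close>.\<close>
  let ?A = "mat (?r\<^sup>2) - ?S"
  have Av: "?A *v w = ?r\<^sup>2 *\<^sub>R w - ?S *v w" for w
  proof -
    have "mat (?r\<^sup>2) *v w = ?r\<^sup>2 *\<^sub>R w"
      by (simp add: vec_eq_iff matrix_vector_mult_def mat_def if_distrib if_distribR cong: if_cong)
    then show ?thesis
      by (simp add: matrix_vector_mult_diff_rdistrib)
  qed
  have Aq: "w \<bullet> (?A *v w) = ?r\<^sup>2 * (norm w)\<^sup>2 - (norm (R *v w))\<^sup>2" for w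
    unfolding Av by (simp add: inner_diff_right quad del: matrix_vector_mul_assoc)
      (simp add: power2_norm_eq_inner)
  have "transpose (B - D) = transpose B - transpose D" for B D :: "real ^ 'n ^ 'n"
    by (simp add: transpose_def vec_eq_iff)
  then have "transpose ?A = ?A"
    by (simp add: matrix_transpose_mul)
  moreover have "0 \<le> w \<bullet> (?A *v w)" for w
    using bound by (simp add: Aq)
  moreover have "v \<bullet> (?A *v v) = 0"
    using v(1) by (simp add: Aq)
  ultimately have "?A *v v = 0"
    by (rule positive_semidefinite_null_vector)
  moreover have "v \<noteq> 0"
    using v(1) by auto
  ultimately have "?r\<^sup>2 \<in> eigenvalues ?S"
    unfolding eigenvalues_def Av by auto
  then have "sqrt (?r\<^sup>2) \<in> singular_values R"
    unfolding singular_values_def by (rule imageI)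
  then have "?r < 1"
    using sv by fastforce
  moreover have "norm (R *v w) \<le> ?r * norm w" for w
    by (rule power2_le_imp_le) (simp_all add: bound power_mult_distrib)
  ultimately show ?thesis
    by (intro that[of ?r]) simp_all
qed

section \<open>Best responses\<close>

lemma positive_definite_lower_bound:
  assumes "symmetric_positive_definite Q"
  obtains m where "m > 0" "\<And>v. m * (norm v)\<^sup>2 \<le> v \<bullet> (Q *v v)"
proof -
  obtain e where "norm e = 1" "\<And>w. (e \<bullet> (Q *v e)) * (norm w)\<^sup>2 \<le> w \<bullet> (Q *v w)"
    using quadratic_form_attains_min[of Q] by blast
  moreover from this have "e \<bullet> (Q *v e) > 0"
    using assms unfolding symmetric_positive_definite_def by (metis norm_zero zero_neq_one)
  ultimately show ?thesis
    using that by blast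
qed

lemma positive_definite_mul_matrix_inv:
  fixes Q :: "real ^ 'n ^ 'n"
  assumes "symmetric_positive_definite Q"
  shows "Q *v (matrix_inv Q *v v) = v"
proof -
  have "\<forall>x. Q *v x = 0 \<longrightarrow> x = 0"
    using assms unfolding symmetric_positive_definite_def by force
  then have "invertible Q"
    using matrix_left_invertible_ker invertible_left_inverse by blast
  then have "Q ** matrix_inv Q = mat 1"
    unfolding invertible_def matrix_inv_def by (rule someI2_ex) blast
  then show ?thesis
    by (simp add: matrix_vector_mul_assoc)
qed

text \<open>Completing the square at the unconstrained minimiser \<open>c\<close>. The last term is
  independent of \<open>u\<close>, so best responses are the lattice points closest to
  \<open>c\<close> in the norm of \<open>Q\<close>.\<close>

lemma objective_eq_squared_distance:
  fixes Q :: "real ^ 'n ^ 'n" and C :: "real ^ 'm ^ 'n" and d :: "real ^ 'n"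
  assumes Q: "symmetric_positive_definite Q"
    and c: "c = - (matrix_inv Q *v (C *v w + d))"
  shows "objective Q C d w u = 1 / 2 * ((u - c) \<bullet> (Q *v (u - c))) - 1 / 2 * (c \<bullet> (Q *v c))"
proof -
  have "C *v w + d = - (Q *v c)"
    using positive_definite_mul_matrix_inv[OF Q, of "C *v w + d"]
      linear_neg[OF matrix_vector_mul_linear[of Q]]
    by (simp add: c)
  moreover have "transpose Q = Q"
    using Q by (simp add: symmetric_positive_definite_def)
  ultimately show ?thesis
    unfolding objective_def by (simp only: quadratic_form_diff inner_minus_left) argo
qed

text \<open>The sublevel set through any lattice point \<open>u0\<close> is bounded because
  \<open>Q\<close> is definite, so it holds finitely many lattice points. A minimiser among these is
  a minimiser over all of \<open>L\<close>.\<close>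

lemma best_responses_nonempty:
  fixes Q :: "real ^ 'n ^ 'n" and C :: "real ^ 'm ^ 'n" and d :: "real ^ 'n"
  assumes L: "full_rank_lattice L" and Q: "symmetric_positive_definite Q"
  shows "best_responses L Q C d w \<noteq> {}"
proof -
  define c where "c = - (matrix_inv Q *v (C *v w + d))"
  define f where "f = objective Q C d w"
  note f = objective_eq_squared_distance[OF Q c_def, folded f_def]
  obtain m where m: "m > 0" "\<And>v. m * (norm v)\<^sup>2 \<le> v \<bullet> (Q *v v)"
    using positive_definite_lower_bound[OF Q] by blast
  \<comment> \<open>The covering property is used here merely to see that \<open>L\<close> is
    nonempty.\<close>
  obtain u0 where u0: "u0 \<in> L"
    using full_rank_lattice_covering_radius[OF L] by metis
  define D where "D = (u0 - c) \<bullet> (Q *v (u0 - c))"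
  let ?T = "{u \<in> L. f u \<le> f u0}"
  have "norm u \<le> norm c + sqrt (D / m)" if "f u \<le> f u0" for u
  proof -
    have "m * (norm (u - c))\<^sup>2 \<le> D"
      using that m(2)[of "u - c"] by (simp add: f D_def)
    then have "norm (u - c) \<le> sqrt (D / m)"
      using m(1) by (intro real_le_rsqrt) (simp add: pos_le_divide_eq mult.commute)
    then show ?thesis
      using norm_triangle_sub[of u c] by linarith
  qed
  then have "finite ?T"
    by (intro finite_subset[OF _ full_rank_lattice_finite_bounded[OF L]]) auto
  moreover have "?T \<noteq> {}"
    using u0 by auto
  ultimately obtain u where u: "u \<in> ?T" "\<And>v. v \<in> ?T \<Longrightarrow> f u \<le> f v"
    using ex_min_if_finite[of "f ` ?T"] by (metis (no_types, lifting) arg_min_if_finite(1) arg_min_least)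
  have "f u \<le> f v" if "v \<in> L" for v
    using u that by (cases "f v \<le> f u0") auto
  then have "is_arg_min f (\<lambda>u. u \<in> L) u"
    using u(1) by (auto simp: is_arg_min_linorder)
  then show ?thesis
    by (auto simp: best_responses_def f_def)
qed

text \<open>The restriction to the lattice costs only an additive constant: a best response is no
  farther from \<open>c\<close> in the norm of \<open>Q\<close> than a lattice point near
  \<open>c\<close>. The dependence on \<open>w\<close> enters through \<open>c\<close> alone, with
  factor \<open>r\<close>.\<close>

lemma best_responses_norm_le:
  fixes Q :: "real ^ 'n ^ 'n" and C :: "real ^ 'm ^ 'n" and d :: "real ^ 'n"
  assumes L: "full_rank_lattice L" and Q: "symmetric_positive_definite Q"
    and sv: "\<forall>s \<in> singular_values (matrix_inv Q ** C). s < 1"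
  obtains r K where "0 \<le> r" "r < 1" "\<And>w u. u \<in> best_responses L Q C d w \<Longrightarrow> norm u \<le> r * norm w + K"
proof -
  obtain r where r: "0 \<le> r" "r < 1" "\<And>w. norm ((matrix_inv Q ** C) *v w) \<le> r * norm w"
    using singular_values_less_one_contraction[OF sv] by blast
  obtain m where m: "m > 0" "\<And>v. m * (norm v)\<^sup>2 \<le> v \<bullet> (Q *v v)"
    using positive_definite_lower_bound[OF Q] by blast
  obtain M where M: "M > 0" "\<And>v. norm (Q *v v) \<le> norm v * M"
    using bounded_linear.pos_bounded[OF matrix_vector_mul_bounded_linear[of Q]] by blast
  obtain \<rho> where \<rho>: "\<And>v. \<exists>u\<in>L. norm (u - v) \<le> \<rho>"
    using full_rank_lattice_covering_radius[OF L] by blast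
  \<comment> \<open>The first summand is the constant part of \<open>c\<close>. The second is the
    covering radius enlarged by \<open>sqrt (M / m)\<close>, the price of passing between the
    Euclidean norm and that of \<open>Q\<close>.\<close>
  define K where "K = norm (matrix_inv Q *v d) + sqrt (M * \<rho>\<^sup>2 / m)"
  have "norm u \<le> r * norm w + K" if u: "u \<in> best_responses L Q C d w" for u w
  proof -
    define c where "c = - (matrix_inv Q *v (C *v w + d))"
    obtain v where v: "v \<in> L" "norm (v - c) \<le> \<rho>"
      using \<rho> by blast
    have "objective Q C d w u \<le> objective Q C d w v"
      using u v(1) by (simp add: best_responses_def is_arg_min_linorder)
    then have "(u - c) \<bullet> (Q *v (u - c)) \<le> (v - c) \<bullet> (Q *v (v - c))"
      by (simp add: objective_eq_squared_distance[OF Q c_def])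
    also have "\<dots> \<le> norm (v - c) * norm (Q *v (v - c))"
      by (rule norm_cauchy_schwarz)
    also have "\<dots> \<le> norm (v - c) * (norm (v - c) * M)"
      by (intro mult_left_mono M norm_ge_zero)
    also have "\<dots> = M * (norm (v - c))\<^sup>2"
      by (simp add: power2_eq_square)
    also have "\<dots> \<le> M * \<rho>\<^sup>2"
      using v(2) M(1) by (intro mult_left_mono power_mono) auto
    finally have "m * (norm (u - c))\<^sup>2 \<le> M * \<rho>\<^sup>2"
      using m(2)[of "u - c"] by linarith
    then have "norm (u - c) \<le> sqrt (M * \<rho>\<^sup>2 / m)"
      using m(1) by (intro real_le_rsqrt) (simp add: pos_le_divide_eq mult.commute)
    moreover have "norm c \<le> r * norm w + norm (matrix_inv Q *v d)"
      unfolding c_def norm_minus_cancel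
      using norm_triangle_ineq[of "(matrix_inv Q ** C) *v w" "matrix_inv Q *v d"] r(3)[of w]
      by (simp add: matrix_vector_right_distrib matrix_vector_mul_assoc)
    ultimately show ?thesis
      using norm_triangle_sub[of u c] by (simp add: K_def)
  qed
  with r that show ?thesis by blast
qed

section \<open>Termination from a finite invariant set\<close>

text \<open>Pigeonhole: a run that never stops would be an injective sequence in \<open>S\<close>.
  Invariance is demanded of every possible step, since the choice of minimiser may vary between
  visits.\<close>

lemma br_algorithm_terminates_if_finite_invariant:
  assumes ne: "\<And>y. BR1 y \<noteq> {}" "\<And>x. BR2 x \<noteq> {}"
    and S: "finite S" "p \<in> S" "\<And>a b. a \<in> S \<Longrightarrow> br_step BR1 BR2 a b \<Longrightarrow> b \<in> S"
  shows "br_algorithm_terminates BR1 BR2 p"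
proof -
  have "\<not> (\<forall>n. br_execution BR1 BR2 p z n)" for z
  proof
    assume z: "\<forall>n. br_execution BR1 BR2 p z n"
    then have step: "z 0 = p" "br_step BR1 BR2 (z i) (z (Suc i))" "\<not> br_stop z i" for i
      unfolding br_execution_def by blast+
    have "z i \<in> S" for i
      by (induction i) (use S step in auto)
    then have "finite (range z)"
      using S(1) by (meson finite_subset image_subsetI)
    moreover have "inj z"
      using step(3) unfolding br_stop_def by (metis injI linorder_neqE_nat)
    ultimately show False
      using finite_imageD by blast
  qed
  moreover have "\<exists>q. br_step BR1 BR2 a q" for a
    using ne(1)[of "snd a"] ne(2)[of "fst a"] unfolding br_step_def by (metis all_not_in_conv fst_conv snd_conv)
  ultimately show ?thesis
    unfolding br_algorithm_terminates_def by blast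
qed

theorem theorem2:
  fixes \<Lambda>1 :: "(real ^ 'nx) set" and \<Lambda>2 :: "(real ^ 'ny) set"
    and Q1 :: "real ^ 'nx ^ 'nx" and Q2 :: "real ^ 'ny ^ 'ny"
    and C1 :: "real ^ 'ny ^ 'nx" and C2 :: "real ^ 'nx ^ 'ny"
    and d1 :: "real ^ 'nx" and d2 :: "real ^ 'ny"
    and x0 :: "real ^ 'nx" and y0 :: "real ^ 'ny"
  assumes "full_rank_lattice \<Lambda>1" and "full_rank_lattice \<Lambda>2"
    and "symmetric_positive_definite Q1" and "symmetric_positive_definite Q2"
    and "positively_adequate Q1 C1 Q2 C2"
    and "x0 \<in> \<Lambda>1" and "y0 \<in> \<Lambda>2"
  shows "br_algorithm_terminates
           (best_responses \<Lambda>1 Q1 C1 d1) (best_responses \<Lambda>2 Q2 C2 d2) (x0, y0)"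
proof -
  obtain r1 K1 where 1: "0 \<le> r1" "r1 < 1"
    "\<And>w u. u \<in> best_responses \<Lambda>1 Q1 C1 d1 w \<Longrightarrow> norm u \<le> r1 * norm w + K1"
    using best_responses_norm_le[OF assms(1,3)] assms(5) unfolding positively_adequate_def by metis
  obtain r2 K2 where 2: "0 \<le> r2" "r2 < 1"
    "\<And>w u. u \<in> best_responses \<Lambda>2 Q2 C2 d2 w \<Longrightarrow> norm u \<le> r2 * norm w + K2"
    using best_responses_norm_le[OF assms(2,4)] assms(5) unfolding positively_adequate_def by metis
  \<comment> \<open>\<open>K / (1 - r)\<close> is the fixed point of
    \<open>s \<mapsto> r * s + K\<close>, so any bound above it is preserved by this map. One
    \<open>B\<close> is shared by both players because each new component is bounded through the
    opponent's old one; the initial norms put the starting point in the box.\<close>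
  define B where "B = Max {norm x0, norm y0, K1 / (1 - r1), K2 / (1 - r2)}"
  have B: "norm x0 \<le> B" "norm y0 \<le> B" "K1 / (1 - r1) \<le> B" "K2 / (1 - r2) \<le> B"
    unfolding B_def by simp_all
  have invariant: "r * s + K \<le> B" if "s \<le> B" "0 \<le> r" "r < 1" "K / (1 - r) \<le> B" for r s K
  proof -
    have "r * s \<le> r * B"
      using that by (intro mult_left_mono) auto
    moreover have "K \<le> B * (1 - r)"
      using that by (simp add: pos_divide_le_eq)
    ultimately show ?thesis
      by (simp add: algebra_simps)
  qed
  let ?S = "{u \<in> \<Lambda>1. norm u \<le> B} \<times> {u \<in> \<Lambda>2. norm u \<le> B}"
  show ?thesis
  proof (rule br_algorithm_terminates_if_finite_invariant)
    show "finite ?S"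
      using assms(1,2) by (intro finite_cartesian_product full_rank_lattice_finite_bounded)
    show "(x0, y0) \<in> ?S"
      using assms(6,7) B by simp
    show "b \<in> ?S" if "a \<in> ?S"
      and "br_step (best_responses \<Lambda>1 Q1 C1 d1) (best_responses \<Lambda>2 Q2 C2 d2) a b" for a b
    proof -
      have br: "fst b \<in> best_responses \<Lambda>1 Q1 C1 d1 (snd a)"
        "snd b \<in> best_responses \<Lambda>2 Q2 C2 d2 (fst a)"
        using that(2) by (auto simp: br_step_def)
      then have "fst b \<in> \<Lambda>1" "snd b \<in> \<Lambda>2"
        by (auto simp: best_responses_def is_arg_min_def)
      moreover have "norm (fst b) \<le> B"
        using 1(3)[OF br(1)] invariant[OF _ 1(1,2) B(3), of "norm (snd a)"] that(1) by auto
      moreover have "norm (snd b) \<le> B"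
        using 2(3)[OF br(2)] invariant[OF _ 2(1,2) B(4), of "norm (fst a)"] that(1) by auto
      ultimately show ?thesis
        by (auto simp: mem_Times_iff)
    qed
  qed (rule best_responses_nonempty assms)+
qed

end
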